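(* Let $f,g:\mathbb{R}^n\to\mathbb{R}$ be homogeneous polynomials of degree $k\ge 1$. Suppose that $f$ and $g$ have no common zero point except $0\in\mathbb{R}^n$, and that there exists at most one vector $(a,b)\in\mathbb{R}^2$ such that $a^2+b^2=1$, $a+\delta(a)b>0$, and both of the systems $\{f(x)=a,\ g(x)=b\}$ and $\{f(x)=-a,\ g(x)=-b\}$ have a solution $x\in\mathbb{R}^n$, where $\delta(t)=1$ if $t=0$ and $\delta(t)=0$ if $t\neq 0$ (that is to say, at most one straight line passing through the origin is contained in the set $U=\{(f(x),g(x)):x\in\mathbb{R}^n\}$). Then the following two items are equivalent: (i) $f$ is copositive with $g$; (ii) there exists $\xi\ge 0$ such that $f(x)-\xi g(x)\ge 0$ for all $x\in\mathbb{R}^n$; in particular, if there exists a vector $z\in\mathbb{R}^n$ such that $f(z)<0$, then there exists $\xi>0$ such that $f(x)-\xi g(x)\ge 0$ for all $x\in\mathbb{R}^n$.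
   Context: A function $f:\mathbb{R}^n\to\mathbb{R}$ is copositive with $g:\mathbb{R}^n\to\mathbb{R}$ if $g(x)\ge 0$ implies $f(x)\ge 0$. Homogeneous polynomials are homogeneous in the usual sense: $f(\epsilon x)=\epsilon^k f(x)$. *)

theory Defs
  imports "HOL-Analysis.Analysis"
begin

text \<open>Polynomials on \<open>\<real>\<^sup>n\<close> are taken as polynomial functions. The scaling law is required for
  all real factors, including negative ones; the zero polynomial is homogeneous of every
  positive degree.\<close>

definition homogeneous_polynomial :: "nat \<Rightarrow> (real ^ 'n \<Rightarrow> real) \<Rightarrow> bool" where
  "homogeneous_polynomial k f \<longleftrightarrow>
     real_polynomial_function f \<and> (\<forall>(\<epsilon>::real) x. f (\<epsilon> *\<^sub>R x) = \<epsilon> ^ k * f x)"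

definition copositive_with :: "(real ^ 'n \<Rightarrow> real) \<Rightarrow> (real ^ 'n \<Rightarrow> real) \<Rightarrow> bool" where
  "copositive_with f g \<longleftrightarrow> (\<forall>x. g x \<ge> 0 \<longrightarrow> f x \<ge> 0)"

definition delta :: "real \<Rightarrow> real" where
  "delta t = (if t = 0 then 1 else 0)"

end

theory Submission
  imports Defs
begin

text \<open>
  Let \<open>U\<close> be the set of all pairs \<open>(f x, g x)\<close>. Homogeneity makes \<open>U\<close> a cone, and copositivity says
  that \<open>U\<close> avoids the quadrant \<open>a < 0\<close>, \<open>b \<ge> 0\<close>. The wanted \<open>\<xi>\<close> is the slope of a line through the
  origin with \<open>U\<close> on one side of it. The only candidate that has to be tried is
  the least \<open>\<xi>\<close> that works for the part of \<open>U\<close> in the quadrant \<open>a \<le> 0\<close>, \<open>b \<le> 0\<close>. By homogeneity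
  that part is governed by unit vectors, a compact set on which \<open>g\<close> is negative (where
  \<open>g\<close> vanishes, copositivity makes \<open>f\<close> vanish too, and there is no common zero). So \<open>f / g\<close>
  attains a maximum \<open>\<xi>\<close> there, at \<open>x\<close> say; if the set is empty, then \<open>f\<close> is nonnegative and
  \<open>\<xi> = 0\<close> works.

  The inequality \<open>f \<ge> \<xi> g\<close> can then fail only at some \<open>y\<close> with \<open>f y \<ge> 0\<close> and \<open>g y > 0\<close>.
  In that case the directions of \<open>P = (f x, g x)\<close> and \<open>Q = (f y, g y)\<close> bound, on the side of the
  positive \<open>a\<close>-axis, an arc longer than a half turn. The segment from \<open>x\<close> to \<open>y\<close> misses the
  origin, since otherwise \<open>P\<close> and \<open>Q\<close> would be parallel, and its image cannot cross the negative
  \<open>a\<close>-axis. Its directions thus sweep out the whole long arc and hit both \<open>-P\<close> and \<open>-Q\<close>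
  (\<open>segment_hits_opposite_direction\<close>). After normalisation (\<open>antipodal_unit_values\<close>) this puts two
  different lines into \<open>U\<close>, which the hypothesis excludes. Joining \<open>x\<close> to \<open>y\<close> by a straight
  segment treats all dimensions, including \<open>n = 1\<close>, and both parities of \<open>k\<close> at once.
\<close>

text \<open>The map \<open>(f, g)\<close> sends the path from a value below the \<open>a\<close>-axis to one above it, and it crosses
  the axis only on the positive side, where \<open>v\<close> below is positive. So \<open>v\<close>, which measures the
  side of the line through \<open>(f y, g y)\<close>, must change sign while \<open>g\<close> is still negative. Taking the
  maximum of \<open>g\<close> and \<open>v\<close> reduces this to a single use of the intermediate value theorem.\<close>

lemma segment_hits_opposite_direction:
  fixes f g :: "'a::real_normed_vector \<Rightarrow> real"
  assumes contf: "continuous_on (closed_segment x y) f"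
    and contg: "continuous_on (closed_segment x y) g"
    and axis: "\<And>z. z \<in> closed_segment x y \<Longrightarrow> g z = 0 \<Longrightarrow> f z > 0"
    and gx: "g x < 0" and gy: "g y > 0"
    and wide: "f x * g y < f y * g x"
  obtains z where "g z < 0" "f z * g y = f y * g z"
proof -
  let ?T = "closed_segment x y"
  define v where "v z = f z * g y - f y * g z" for z
  define m where "m z = max (g z) (v z)" for z
  have "continuous_on ?T m"
    unfolding m_def v_def by (intro continuous_intros contf contg)
  then have "connected (m ` ?T)"
    by (intro connected_continuous_image) auto
  moreover have "m x \<le> 0" "0 \<le> m y"
    using gx gy wide by (auto simp: m_def v_def)
  ultimately have "0 \<in> m ` ?T"
    by (meson connectedD_interval ends_in_segment imageI)
  then obtain z where z: "z \<in> ?T" and mz: "m z = 0" by auto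
  have "g z \<noteq> 0"
  proof
    assume "g z = 0"
    then have "v z > 0" using axis[OF z] gy by (simp add: v_def)
    then show False using mz by (simp add: m_def)
  qed
  then have "g z < 0" "v z = 0"
    using mz by (auto simp: m_def max_def split: if_splits)
  then show ?thesis by (intro that[of z]) (auto simp: v_def)
qed

lemma homogeneous_polynomial_scaleR:
  "homogeneous_polynomial k f \<Longrightarrow> f (c *\<^sub>R x) = c ^ k * f x"
  by (simp add: homogeneous_polynomial_def)

lemma homogeneous_polynomial_zero:
  assumes "k \<ge> 1" "homogeneous_polynomial k f"
  shows "f 0 = 0"
  using homogeneous_polynomial_scaleR[OF assms(2), of 0 0] assms(1) by (simp add: power_0_left)

lemma homogeneous_polynomial_continuous_on:
  assumes "homogeneous_polynomial k f"
  shows "continuous_on S f"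
  using assms unfolding homogeneous_polynomial_def
  by (auto intro: continuous_on_polymonial_function simp: real_polynomial_function_eq)

lemma homogeneous_polynomial_attains_scaled_values:
  assumes "k \<ge> 1" "homogeneous_polynomial k f" "homogeneous_polynomial k g" "s > 0"
  obtains t where "f (t *\<^sub>R x) = s * f x" "g (t *\<^sub>R x) = s * g x"
proof
  have "root k s ^ k = s" using assms by simp
  then show "f (root k s *\<^sub>R x) = s * f x" "g (root k s *\<^sub>R x) = s * g x"
    using assms by (auto simp: homogeneous_polynomial_def)
qed

text \<open>Two values of \<open>(f, g)\<close> in opposite directions yield a unit vector and its antipode as values.\<close>

lemma antipodal_unit_values:
  assumes hom: "k \<ge> 1" "homogeneous_polynomial k f" "homogeneous_polynomial k g"
    and nz: "g x \<noteq> 0"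
    and opp: "g z * g x < 0" "f z * g x = f x * g z"
  defines "r \<equiv> sqrt ((f x)\<^sup>2 + (g x)\<^sup>2)"
  shows "r > 0" "(f x / r)\<^sup>2 + (g x / r)\<^sup>2 = 1"
    "\<exists>w. f w = f x / r \<and> g w = g x / r" "\<exists>w. f w = - (f x / r) \<and> g w = - (g x / r)"
proof -
  have pos: "(f x)\<^sup>2 + (g x)\<^sup>2 > 0" using nz by (simp add: sum_power2_gt_zero_iff)
  then show r: "r > 0" by (simp add: r_def)
  have "r\<^sup>2 = (f x)\<^sup>2 + (g x)\<^sup>2" using pos by (simp add: r_def)
  then have "((f x)\<^sup>2 + (g x)\<^sup>2) / r\<^sup>2 = 1" using r by (metis divide_self power_not_zero less_irrefl)
  then show "(f x / r)\<^sup>2 + (g x / r)\<^sup>2 = 1" by (simp add: power_divide add_divide_distrib)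
  show "\<exists>w. f w = f x / r \<and> g w = g x / r"
    using homogeneous_polynomial_attains_scaled_values[OF hom, of "1 / r" x] r by auto
  \<comment> \<open>The factor that turns the value at \<open>z\<close> into the negative of the normalised value at \<open>x\<close>.\<close>
  define s where "s = - (g x / g z) / r"
  have "g x / g z < 0" using opp(1) by (simp add: mult_less_0_iff divide_less_0_iff) argo
  then have "s > 0" unfolding s_def using r by (intro divide_pos_pos) simp
  then obtain t where "f (t *\<^sub>R z) = s * f z" "g (t *\<^sub>R z) = s * g z"
    using homogeneous_polynomial_attains_scaled_values[OF hom] by blast
  moreover have gz: "g z \<noteq> 0" using opp(1) by auto
  moreover have "s * g z = - (g x / r)" using gz by (simp add: s_def)
  moreover have "s * f z = - (f x / r)" using gz opp(2) r by (simp add: s_def field_simps)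
  ultimately show "\<exists>w. f w = - (f x / r) \<and> g w = - (g x / r)" by metis
qed

text \<open>The quotient \<open>f / g\<close> on the half \<open>g < 0\<close> never exceeds its values on the half \<open>g > 0\<close>, in a form
  free of division. A violation would give an arc of directions longer than a half turn, hence
  two lines in the image.\<close>

lemma ratio_ordered_if_at_most_one_line:
  fixes f g :: "real ^ 'n \<Rightarrow> real"
  assumes hom: "k \<ge> 1" "homogeneous_polynomial k f" "homogeneous_polynomial k g"
    and nocommon: "\<And>x. f x = 0 \<Longrightarrow> g x = 0 \<Longrightarrow> x = 0"
    and one_line: "\<exists>\<^sub>\<le>\<^sub>1(a, b). a\<^sup>2 + b\<^sup>2 = 1 \<and> a + delta a * b > 0 \<and>
           (\<exists>x. f x = a \<and> g x = b) \<and> (\<exists>x. f x = - a \<and> g x = - b)"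
    and copos: "copositive_with f g"
    and gx: "g x < 0" and gy: "g y > 0"
  shows "f x * g y \<ge> f y * g x"
proof (rule ccontr)
  assume "\<not> f x * g y \<ge> f y * g x"
  then have wide: "f x * g y < f y * g x" by simp
  have fy: "f y \<ge> 0" using copos gy by (auto simp: copositive_with_def)
  then have "f x * g y < 0" using wide gx by (smt (verit) mult_nonneg_nonpos)
  then have fx: "f x < 0" using gy by (simp add: mult_less_0_iff)
  note scale = homogeneous_polynomial_scaleR[OF hom(2)] homogeneous_polynomial_scaleR[OF hom(3)]
  note cont = homogeneous_polynomial_continuous_on[OF hom(2)]
    homogeneous_polynomial_continuous_on[OF hom(3)]
  let ?T = "closed_segment x y"
  have "0 \<notin> ?T"
  proof
    assume "0 \<in> ?T"
    then obtain u where u: "0 \<le> u" "u \<le> 1" "(1 - u) *\<^sub>R x + u *\<^sub>R y = 0"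
      by (auto simp: in_segment)
    have "x \<noteq> 0" using gx homogeneous_polynomial_zero[OF hom(1,3)] by auto
    then have "u \<noteq> 0" using u(3) by auto
    have "y = (1 / u) *\<^sub>R (u *\<^sub>R y)" using \<open>u \<noteq> 0\<close> by simp
    also have "u *\<^sub>R y = - (1 - u) *\<^sub>R x" using u(3)
      by (metis add_eq_0_iff scaleR_minus_left)
    finally obtain c where "y = c *\<^sub>R x" by (metis scaleR_scaleR)
    then have "f x * g y = f y * g x" by (simp add: scale)
    then show False using wide by simp
  qed
  have axis: "f z > 0" if "z \<in> ?T" "g z = 0" for z
  proof -
    have "f z \<ge> 0" using copos that(2) by (simp add: copositive_with_def)
    moreover have "f z \<noteq> 0" using nocommon that \<open>0 \<notin> ?T\<close> by blast
    ultimately show ?thesis by simp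
  qed
  obtain z where z: "g z < 0" "f z * g y = f y * g z"
    using segment_hits_opposite_direction[OF cont axis gx gy wide] by blast
  \<comment> \<open>Reflecting in the \<open>a\<close>-axis exchanges the two ends of the segment, so the same lemma also
    yields the direction opposite to the value at \<open>x\<close>.\<close>
  obtain w where w: "g w > 0" "f w * g x = f x * g w"
  proof (rule segment_hits_opposite_direction[of y x f "\<lambda>z. - g z"])
    show "continuous_on (closed_segment y x) f" "continuous_on (closed_segment y x) (\<lambda>z. - g z)"
      by (intro continuous_intros cont)+
    show "f z > 0" if "z \<in> closed_segment y x" "- g z = 0" for z
      using axis that by (simp add: closed_segment_commute)
  qed (use gx gy wide in auto)
  define r q where "r = sqrt ((f x)\<^sup>2 + (g x)\<^sup>2)" and "q = sqrt ((f y)\<^sup>2 + (g y)\<^sup>2)"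
  have "g w * g x < 0" "g z * g y < 0" using w z gx gy by (auto simp: mult_less_0_iff)
  then have X: "r > 0" "(f x / r)\<^sup>2 + (g x / r)\<^sup>2 = 1"
      "\<exists>w. f w = f x / r \<and> g w = g x / r" "\<exists>w. f w = - (f x / r) \<and> g w = - (g x / r)"
    and Y: "q > 0" "(f y / q)\<^sup>2 + (g y / q)\<^sup>2 = 1"
      "\<exists>w. f w = f y / q \<and> g w = g y / q" "\<exists>w. f w = - (f y / q) \<and> g w = - (g y / q)"
    using antipodal_unit_values[OF hom] w(2) z(2) gx gy unfolding r_def q_def by auto
  \<comment> \<open>Of each antipodal pair the hypothesis counts one member: the one with \<open>a > 0\<close>, or \<open>b > 0\<close> if
    \<open>a = 0\<close>. Here these are the negative of the value at \<open>x\<close>, and the value at \<open>y\<close>.\<close>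
  have neg: "- (f x / r) > 0" using divide_neg_pos[OF fx X(1)] by linarith
  then have "delta (- (f x / r)) = 0" unfolding delta_def by (metis less_irrefl)
  then have repx: "- (f x / r) + delta (- (f x / r)) * - (g x / r) > 0" using neg by simp
  have repy: "f y / q + delta (f y / q) * (g y / q) > 0"
  proof (cases "f y = 0")
    case True
    then show ?thesis using gy Y(1) by (simp add: delta_def)
  next
    case False
    then have "f y / q > 0" using fy Y(1) by simp
    moreover from this have "delta (f y / q) = 0" unfolding delta_def by (metis less_irrefl)
    ultimately show ?thesis by simp
  qed
  have "(- (f x / r), - (g x / r)) = (f y / q, g y / q)"
    by (rule Uniq_D[OF one_line]) (use X Y repx repy in auto)
  then have "g y / q = - (g x / r)" "f y / q = - (f x / r)" by auto
  then have "g y = q * - (g x / r)" "f y = q * - (f x / r)"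
    using Y(1) by (auto simp: field_simps)
  then have "f x * g y = f y * g x" by simp
  then show False using wide by simp
qed

text \<open>The lower bounds for \<open>\<xi>\<close> come from the points with \<open>g < 0\<close>, the upper bounds from those with
  \<open>g > 0\<close>. Compactness makes the best lower bound finite and attained, so that comparing it with
  the upper bounds is comparing two values of \<open>f / g\<close>.\<close>

lemma copositive_imp_supporting_slope:
  fixes f g :: "real ^ 'n \<Rightarrow> real"
  assumes hom: "k \<ge> 1" "homogeneous_polynomial k f" "homogeneous_polynomial k g"
    and nocommon: "\<And>x. f x = 0 \<Longrightarrow> g x = 0 \<Longrightarrow> x = 0"
    and one_line: "\<exists>\<^sub>\<le>\<^sub>1(a, b). a\<^sup>2 + b\<^sup>2 = 1 \<and> a + delta a * b > 0 \<and>
           (\<exists>x. f x = a \<and> g x = b) \<and> (\<exists>x. f x = - a \<and> g x = - b)"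
    and copos: "copositive_with f g"
  shows "\<exists>\<xi>\<ge>0. \<forall>x. f x - \<xi> * g x \<ge> 0"
proof -
  note scale = homogeneous_polynomial_scaleR[OF hom(2)] homogeneous_polynomial_scaleR[OF hom(3)]
  note cont = homogeneous_polynomial_continuous_on[OF hom(2)]
    homogeneous_polynomial_continuous_on[OF hom(3)]
  \<comment> \<open>Including \<open>f x = 0\<close> keeps the set closed and still gives a nonnegative maximum of \<open>f / g\<close>.\<close>
  define K where "K = sphere 0 1 \<inter> {x. f x \<le> 0 \<and> g x \<le> 0}"
  have "closed {x. f x \<le> 0 \<and> g x \<le> 0}"
    by (intro closed_Collect_conj closed_Collect_le cont continuous_intros)
  then have "compact K" unfolding K_def by (intro compact_Int_closed) auto
  have Kneg: "g x < 0" if "x \<in> K" for x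
  proof (rule ccontr)
    assume "\<not> g x < 0"
    then have "g x = 0" using that by (simp add: K_def)
    moreover from this have "f x \<ge> 0" using copos by (simp add: copositive_with_def)
    then have "f x = 0" using that by (simp add: K_def)
    ultimately have "x = 0" using nocommon by blast
    then show False using that by (simp add: K_def)
  qed
  have below: "(1 / norm x) *\<^sub>R x \<in> K" "g x < 0" if "f x < 0" for x
  proof -
    show "g x < 0" using copos that unfolding copositive_with_def by (metis not_le)
    moreover have "x \<noteq> 0" using that homogeneous_polynomial_zero[OF hom(1,2)] by auto
    ultimately show "(1 / norm x) *\<^sub>R x \<in> K"
      using that by (simp add: K_def scale zero_le_divide_iff mult_le_0_iff divide_le_0_iff)
  qed
  show ?thesis
  proof (cases "K = {}")
    case True
    then have "\<forall>x. f x \<ge> 0" using below(1) by (metis empty_iff not_le)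
    then show ?thesis by (intro exI[of _ 0]) simp
  next
    case False
    have "continuous_on K (\<lambda>x. f x / g x)"
      using Kneg by (intro continuous_intros cont) force
    then obtain x where x: "x \<in> K" and max: "\<And>z. z \<in> K \<Longrightarrow> f z / g z \<le> f x / g x"
      using continuous_attains_sup[OF \<open>compact K\<close> False] by blast
    define \<xi> where "\<xi> = f x / g x"
    have gx: "g x < 0" using Kneg x .
    have "\<xi> \<ge> 0" using x by (auto simp: K_def \<xi>_def divide_nonpos_nonpos)
    moreover have "f y - \<xi> * g y \<ge> 0" for y
    proof -
      consider "f y < 0" | "f y \<ge> 0" "g y \<le> 0" | "g y > 0" by linarith
      then show ?thesis
      proof cases
        case 1
        let ?z = "(1 / norm y) *\<^sub>R y"
        have "y \<noteq> 0" using 1 homogeneous_polynomial_zero[OF hom(1,2)] by auto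
        then have "f y / g y = f ?z / g ?z" by (simp add: scale)
        also have "\<dots> \<le> \<xi>" using max below(1)[OF 1] by (simp add: \<xi>_def)
        finally show ?thesis using below(2)[OF 1] by (simp add: divide_le_eq)
      next
        case 2
        then show ?thesis using mult_nonneg_nonpos[OF \<open>\<xi> \<ge> 0\<close>, of "g y"] by simp
      next
        case 3
        have "f x * g y \<ge> f y * g x"
          by (rule ratio_ordered_if_at_most_one_line[OF hom nocommon one_line copos gx 3])
        then have "f x / g x * g y \<le> f y" using gx by (simp add: field_simps)
        then show ?thesis by (simp add: \<xi>_def)
      qed
    qed
    ultimately show ?thesis by blast
  qed
qed

theorem theorem2p5:
  fixes f g :: "real ^ 'n \<Rightarrow> real" and k :: nat
  assumes "k \<ge> 1"
    and "homogeneous_polynomial k f"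
    and "homogeneous_polynomial k g"
    and "\<And>x. f x = 0 \<Longrightarrow> g x = 0 \<Longrightarrow> x = 0"
    and "\<exists>\<^sub>\<le>\<^sub>1(a, b). a\<^sup>2 + b\<^sup>2 = 1 \<and> a + delta a * b > 0 \<and>
           (\<exists>x. f x = a \<and> g x = b) \<and> (\<exists>x. f x = - a \<and> g x = - b)"
  shows "(copositive_with f g \<longleftrightarrow> (\<exists>\<xi>\<ge>0. \<forall>x. f x - \<xi> * g x \<ge> 0)) \<and>
         (copositive_with f g \<and> (\<exists>z. f z < 0) \<longrightarrow> (\<exists>\<xi>>0. \<forall>x. f x - \<xi> * g x \<ge> 0))"
proof (intro conjI iffI impI)
  show slope: "\<exists>\<xi>\<ge>0. \<forall>x. f x - \<xi> * g x \<ge> 0" if "copositive_with f g"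
    by (rule copositive_imp_supporting_slope[OF assms that])
  show "copositive_with f g" if "\<exists>\<xi>\<ge>0. \<forall>x. f x - \<xi> * g x \<ge> 0"
    unfolding copositive_with_def
  proof (intro allI impI)
    fix x assume "g x \<ge> 0"
    from that obtain \<xi> where "\<xi> \<ge> 0" "f x - \<xi> * g x \<ge> 0" by auto
    moreover from this \<open>g x \<ge> 0\<close> have "\<xi> * g x \<ge> 0" by simp
    ultimately show "f x \<ge> 0" by linarith
  qed
  show "\<exists>\<xi>>0. \<forall>x. f x - \<xi> * g x \<ge> 0" if "copositive_with f g \<and> (\<exists>z. f z < 0)"
  proof -
    from that obtain z where z: "f z < 0" by blast
    from slope that obtain \<xi> where \<xi>: "\<xi> \<ge> 0" "\<forall>x. f x - \<xi> * g x \<ge> 0" by auto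
    have "\<xi> \<noteq> 0" using \<xi>(2)[rule_format, of z] z by auto
    then have "\<xi> > 0" using \<xi>(1) by simp
    with \<xi>(2) show ?thesis by (intro exI[of _ \<xi>] conjI)
  qed
qed

end
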